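(* Let $\Sigma$ be a finite alphabet, $V=\mathbb K^d$ with $d\ge1$, and let $r=\langle V,\boldsymbol\iota,\{\mathbf M^\sigma\}_{\sigma\in\Sigma},\boldsymbol\tau\rangle$ be a recognizable series on $\Sigma^*$, i.e. $r(u_1\cdots u_n)=\boldsymbol\iota^\top\mathbf M^{u_1}\cdots\mathbf M^{u_n}\boldsymbol\tau$ for all $u_1\cdots u_n\in\Sigma^*$, where $\boldsymbol\iota,\boldsymbol\tau\in V$ and $\mathbf M^\sigma\in\mathbb K^{d\times d}$. For each $w\in\Sigma^*$ let $G_w$ be its associated hypergraph over the ranked alphabet $(\Sigma\cup\{\iota,\tau\},\sharp)$, as defined in the context. Consider the HWM $M=\langle V,\{T^x\}_{x\in\Sigma\cup\{\iota,\tau\}},\odot_{id},\mathbf 1\rangle$ where $T^\tau=\boldsymbol\tau$, $T^\iota=\boldsymbol\iota$ and $T^\sigma=\mathbf M^\sigma$ for all $\sigma\in\Sigma$. Then $r(w)=r_M(G_w)$ for all strings $w\in\Sigma^*$.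
   Context: Throughout, $\mathbb K=\mathbb R$ or $\mathbb C$, $[d]=\{1,\dots,d\}$, and $(\mathbf e_1,\dots,\mathbf e_d)$ is the canonical basis of $\mathbb K^d$. A ranked alphabet $(\Sigma,\sharp)$ is a finite set $\Sigma$ with an arity map $\sharp:\Sigma\to\mathbb N$; it is positive if $\sharp x\ge 1$ for all $x\in\Sigma$. A hypergraph $G=(V,E,l)$ over a positive ranked alphabet $(\Sigma,\sharp)$ consists of a non-empty finite set $V$ (vertices), a map $l:V\to\Sigma$, and a partition $E$ (whose non-empty blocks are called hyperedges) of the set of ports $P_G=\{(v,j): v\in V, 1\le j\le \sharp v\}$, where $\sharp v=\sharp l(v)$. A product on $\mathbb K^d$ is a bilinear map $\odot:\mathbb K^d\times\mathbb K^d\to\mathbb K^d$ that is associative and symmetric; the identity product $\odot_{id}$ is given by $\mathbf e_i\odot_{id}\mathbf e_j=\delta_{ij}\mathbf e_i$. Write $\mathbf 1=(1,\dots,1)^\top$. A rank $d$ Hypergraph Weighted Model (HWM) over $(\Sigma,\sharp)$ is a tuple $M=\langle \mathbb K^d,\{T^x\}_{x\in\Sigma},\odot,\alpha\rangle$ where $\odot$ is a product on $\mathbb K^d$, $\alpha\in\mathbb K^d$, and $T^x\in\bigotimes^{\sharp x}\mathbb K^d$ (viewed as an array $(T^x_{i_1\dots i_{\sharp x}})$; a matrix is an order 2 tensor) for each $x$. It computes the series $$r_M(G)=\sum_{\gamma:P_G\to[d]}\ \Big(\prod_{v\in V}T^{l(v)}_{\gamma(v,1)\dots\gamma(v,\sharp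 v)}\Big)\prod_{h\in E}\alpha^\top\Big(\bigodot_{p\in h}\mathbf e_{\gamma(p)}\Big)$$ (one factor for each port of $h$). Hypergraph of a string: for a string $w=w_1\cdots w_n$ over $\Sigma$ ($n\ge0$), $G_w$ is the hypergraph over $(\Sigma\cup\{\iota,\tau\},\sharp)$, where $\iota,\tau$ are new symbols, $\sharp x=2$ for $x\in\Sigma$ and $\sharp\iota=\sharp\tau=1$, with vertices $\{0,\dots,n+1\}$, labels $l(0)=\iota$, $l(n+1)=\tau$, $l(i)=w_i$ for $1\le i\le n$, and hyperedges $h_0=\{(0,1),(1,1)\}$ and $h_i=\{(i,2),(i+1,1)\}$ for $1\le i\le n$. *)

theory Defs
  imports "HOL-Analysis.Analysis" "HOL-Library.Disjoint_Sets" "HOL-Library.FuncSet"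
begin

text \<open>
  Scalars: the definitions make sense over any field.  For the field "R or C" we use the class
  \<^class>\<open>real_normed_field\<close>; both \<^typ>\<open>real\<close> and \<^typ>\<open>complex\<close> are instances and, by the
  Gelfand-Mazur theorem, every instance is isomorphic to one of them.
  The space \<open>K\<^sup>d\<close> is \<open>'k ^ 'd\<close> for a finite (automatically nonempty) index type \<open>'d\<close>, which
  plays the role of \<open>[d]\<close>; its canonical basis is \<open>axis i 1\<close>.
\<close>

definition positive_ranked_alphabet :: "'x set \<Rightarrow> ('x \<Rightarrow> nat) \<Rightarrow> bool" where
  "positive_ranked_alphabet X ar \<longleftrightarrow> finite X \<and> (\<forall>x\<in>X. 1 \<le> ar x)"

record ('v, 'x) hypergraph =
  verts :: "'v set"
  edges :: "('v \<times> nat) set set"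
  label :: "'v \<Rightarrow> 'x"

definition ports :: "('x \<Rightarrow> nat) \<Rightarrow> ('v, 'x) hypergraph \<Rightarrow> ('v \<times> nat) set" where
  "ports ar G = (SIGMA v : verts G. {1..ar (label G v)})"

text \<open>
  \<^const>\<open>partition_on\<close> excludes empty blocks, so \<open>edges G\<close> is exactly the set of hyperedges.
\<close>

definition hypergraph_over ::
    "'x set \<Rightarrow> ('x \<Rightarrow> nat) \<Rightarrow> ('v, 'x) hypergraph \<Rightarrow> bool" where
  "hypergraph_over X ar G \<longleftrightarrow>
     positive_ranked_alphabet X ar \<and>
     finite (verts G) \<and> verts G \<noteq> {} \<and>
     label G \<in> verts G \<rightarrow> X \<and>
     partition_on (ports ar G) (edges G)"

definition is_product :: "('k::field ^ 'd \<Rightarrow> 'k ^ 'd \<Rightarrow> 'k ^ 'd) \<Rightarrow> bool" where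
  "is_product pr \<longleftrightarrow>
     abel_semigroup pr \<and>
     (\<forall>x. Vector_Spaces.linear (*s) (*s) (\<lambda>y. pr x y)) \<and>
     (\<forall>y. Vector_Spaces.linear (*s) (*s) (\<lambda>x. pr x y))"

text \<open>The bilinear extension of \<open>e\<^sub>i \<odot> e\<^sub>j = \<delta>\<^sub>i\<^sub>j e\<^sub>i\<close>.\<close>

definition id_product :: "'k::field ^ 'd \<Rightarrow> 'k ^ 'd \<Rightarrow> 'k ^ 'd" where
  "id_product x y =
     (\<Sum>i\<in>UNIV. \<Sum>j\<in>UNIV. (x $ i * y $ j) *s (if i = j then axis i 1 else 0))"

lemma id_product_axis:
  "id_product (axis i 1) (axis j 1 :: 'k::field ^ 'd) = (if i = j then axis i 1 else 0)"
proof -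
  have "id_product (axis i 1) (axis j 1 :: 'k ^ 'd) =
      (\<Sum>a\<in>UNIV. \<Sum>b\<in>UNIV. if b = j then (if a = i then (if a = b then axis a 1 else 0) else 0) else 0)"
    unfolding id_product_def by (intro sum.cong refl) (auto simp: axis_def)
  then show ?thesis by simp
qed

lemma id_product_componentwise: "id_product x y = (\<chi> i. x $ i * y $ i)"
proof -
  have "id_product x y = (\<Sum>i\<in>UNIV. (x $ i * y $ i) *s axis i 1)"
    unfolding id_product_def by (simp add: if_distrib cong: if_cong)
  also have "\<dots> = (\<chi> i. x $ i * y $ i)"
    by (simp add: vec_eq_iff axis_def if_distrib cong: if_cong)
  finally show ?thesis .
qed

lemma is_product_id_product: "is_product (id_product :: 'k::field ^ 'd \<Rightarrow> _)"
  unfolding is_product_def id_product_componentwise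
  by (auto simp: abel_semigroup_def semigroup_def abel_semigroup_axioms_def
      Vector_Spaces.linear_iff vec.vector_space_axioms vec_eq_iff algebra_simps
      intro!: vec.vector_space_axioms)

text \<open>
  A product need not have a unit, so \<^const>\<open>prod\<close>-like constants do not apply.  As for \<^const>\<open>Max\<close>,
  the fold starts from an artificial unit \<^const>\<open>None\<close>; the value is meaningful for finite
  nonempty index sets, on which associativity and symmetry make it independent of the order.
\<close>

definition big_product :: "('b \<Rightarrow> 'b \<Rightarrow> 'b) \<Rightarrow> ('p \<Rightarrow> 'b) \<Rightarrow> 'p set \<Rightarrow> 'b" where
  "big_product pr f h =
     the (Finite_Set.fold
       (\<lambda>p z. Some (case z of None \<Rightarrow> f p | Some y \<Rightarrow> pr (f p) y)) None h)"

lemma big_product_singleton: "big_product pr f {p} = f p"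
proof -
  let ?F = "\<lambda>p z. Some (case z of None \<Rightarrow> f p | Some y \<Rightarrow> pr (f p) y)"
  have "fold_graph ?F None {p} z \<longleftrightarrow> z = Some (f p)" for z
  proof
    assume "fold_graph ?F None {p} z"
    then show "z = Some (f p)"
    proof cases
      case (insertI x A y)
      then have "A = {}" "x = p" by auto
      with insertI(4) have "y = None" by (auto elim: fold_graph.cases)
      with insertI \<open>x = p\<close> show ?thesis by simp
    qed simp
  next
    assume "z = Some (f p)"
    then show "fold_graph ?F None {p} z"
      using fold_graph.insertI[of p "{}" ?F None None] by (simp add: fold_graph.emptyI)
  qed
  then have "fold_graph ?F None {p} = (\<lambda>z. z = Some (f p))" by (intro ext)
  then show ?thesis unfolding big_product_def Finite_Set.fold_def by simp
qed

lemma big_product_insert: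
  assumes "abel_semigroup pr" "finite h" "h \<noteq> {}" "p \<notin> h"
  shows "big_product pr f (insert p h) = pr (f p) (big_product pr f h)"
proof -
  interpret abel_semigroup pr by fact
  interpret comp_fun_commute "\<lambda>p z. Some (case z of None \<Rightarrow> f p | Some y \<Rightarrow> pr (f p) y)"
    by standard (auto simp: fun_eq_iff commute left_commute split: option.split)
  obtain q h' where h: "h = insert q h'" "q \<notin> h'" "finite h'"
    using assms(2,3) by (metis finite.cases finite_insert insert_absorb mk_disjoint_insert)
  show ?thesis using assms(2,4) h by (simp add: big_product_def)
qed

text \<open>
  A tensor of order \<open>n\<close> is the array of its components, indexed by lists of length \<open>n\<close> and
  extended by 0 to lists of other lengths.
\<close>

definition tensor_space :: "nat \<Rightarrow> ('d list \<Rightarrow> 'k::field) set" where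
  "tensor_space n = {T. \<forall>js. length js \<noteq> n \<longrightarrow> T js = 0}"

definition tensor_of_vec :: "'k::field ^ 'd \<Rightarrow> 'd list \<Rightarrow> 'k" where
  "tensor_of_vec v js = (case js of [i] \<Rightarrow> v $ i | _ \<Rightarrow> 0)"

definition tensor_of_matrix :: "'k::field ^ 'd ^ 'd \<Rightarrow> 'd list \<Rightarrow> 'k" where
  "tensor_of_matrix A js = (case js of [i, j] \<Rightarrow> A $ i $ j | _ \<Rightarrow> 0)"

record ('k, 'd, 'x) hwm =
  tensor :: "'x \<Rightarrow> 'd list \<Rightarrow> 'k"
  mult :: "'k ^ 'd \<Rightarrow> 'k ^ 'd \<Rightarrow> 'k ^ 'd"
  alpha :: "'k ^ 'd"

definition hwm_over ::
    "'x set \<Rightarrow> ('x \<Rightarrow> nat) \<Rightarrow> ('k::field, 'd::finite, 'x) hwm \<Rightarrow> bool" where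
  "hwm_over X ar M \<longleftrightarrow>
     positive_ranked_alphabet X ar \<and>
     is_product (mult M) \<and> (\<forall>x\<in>X. tensor M x \<in> tensor_space (ar x))"

text \<open>\<open>x\<^sup>\<top>y\<close>, without conjugation in the complex case.\<close>

definition dot :: "'k::field ^ 'd \<Rightarrow> 'k ^ 'd \<Rightarrow> 'k" where
  "dot x y = (\<Sum>i\<in>UNIV. x $ i * y $ i)"

definition hwm_series ::
    "('x \<Rightarrow> nat) \<Rightarrow> ('k::field, 'd::finite, 'x) hwm \<Rightarrow> ('v, 'x) hypergraph \<Rightarrow> 'k" where
  "hwm_series ar M G =
     (\<Sum>\<gamma> \<in> ports ar G \<rightarrow>\<^sub>E (UNIV :: 'd set).
        (\<Prod>v\<in>verts G. tensor M (label G v) (map (\<lambda>j. \<gamma> (v, j)) [1..<Suc (ar (label G v))])) *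
        (\<Prod>h\<in>edges G. dot (alpha M) (big_product (mult M) (\<lambda>p. axis (\<gamma> p) 1) h)))"

datatype 'a symbol = Letter 'a | Iota | Tau

definition string_alphabet :: "'a set \<Rightarrow> 'a symbol set" where
  "string_alphabet \<Sigma> = Letter ` \<Sigma> \<union> {Iota, Tau}"

fun string_arity :: "'a symbol \<Rightarrow> nat" where
  "string_arity (Letter _) = 2"
| "string_arity Iota = 1"
| "string_arity Tau = 1"

definition string_hypergraph :: "'a list \<Rightarrow> (nat, 'a symbol) hypergraph" where
  "string_hypergraph w =
     \<lparr> verts = {0..length w + 1},
       edges = insert {(0, 1), (1, 1)} ((\<lambda>i. {(i, 2), (i + 1, 1)}) ` {1..length w}),
       label = (\<lambda>i. if i = 0 then Iota
                    else if i = length w + 1 then Tau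
                    else Letter (w ! (i - 1))) \<rparr>"

fun string_tensors ::
    "'k::field ^ 'd \<Rightarrow> ('a \<Rightarrow> 'k ^ 'd ^ 'd) \<Rightarrow> 'k ^ 'd \<Rightarrow> 'a symbol \<Rightarrow> 'd list \<Rightarrow> 'k" where
  "string_tensors \<iota> M \<tau> (Letter \<sigma>) = tensor_of_matrix (M \<sigma>)"
| "string_tensors \<iota> M \<tau> Iota = tensor_of_vec \<iota>"
| "string_tensors \<iota> M \<tau> Tau = tensor_of_vec \<tau>"

definition word_matrix :: "('a \<Rightarrow> 'k::field ^ 'd ^ 'd) \<Rightarrow> 'a list \<Rightarrow> 'k ^ 'd ^ 'd" where
  "word_matrix M u = foldr (\<lambda>\<sigma> A. M \<sigma> ** A) u (mat 1)"

lemma positive_string_alphabet: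
  "finite \<Sigma> \<Longrightarrow> positive_ranked_alphabet (string_alphabet \<Sigma>) string_arity"
  by (auto simp: positive_ranked_alphabet_def string_alphabet_def)

lemma hypergraph_over_string_hypergraph:
  assumes "finite \<Sigma>" "w \<in> lists \<Sigma>"
  shows "hypergraph_over (string_alphabet \<Sigma>) string_arity (string_hypergraph w)"
proof -
  let ?n = "length w"
  let ?G = "string_hypergraph w"
  have lab: "label ?G \<in> verts ?G \<rightarrow> string_alphabet \<Sigma>"
  proof
    fix i assume "i \<in> verts ?G"
    then have i: "i \<le> ?n + 1" by (simp add: string_hypergraph_def)
    have "w ! (i - 1) \<in> \<Sigma>" if "i \<noteq> 0" "i \<noteq> ?n + 1"
    proof -
      have "i - 1 < ?n" using that i by linarith
      then show ?thesis using assms(2) by (meson in_lists_conv_set nth_mem)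
    qed
    then show "label ?G i \<in> string_alphabet \<Sigma>"
      by (auto simp: string_hypergraph_def string_alphabet_def)
  qed
  have port: "(v, j) \<in> ports string_arity ?G \<longleftrightarrow>
      v \<le> ?n + 1 \<and> (j = 1 \<or> j = 2 \<and> 1 \<le> v \<and> v \<le> ?n)" for v j
    by (auto simp: ports_def string_hypergraph_def)
  have edge: "h \<in> edges ?G \<longleftrightarrow>
      h = {(0, 1), (1, 1)} \<or> (\<exists>i. 1 \<le> i \<and> i \<le> ?n \<and> h = {(i, 2), (i + 1, 1)})" for h
    by (simp add: string_hypergraph_def image_iff Bex_def conj_assoc)
  have part: "partition_on (ports string_arity ?G) (edges ?G)"
  proof (rule partition_onI)
    show "\<Union> (edges ?G) = ports string_arity ?G"
    proof (intro equalityI subsetI)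
      fix p assume "p \<in> \<Union> (edges ?G)"
      then show "p \<in> ports string_arity ?G" unfolding Union_iff Bex_def edge
        by (cases p) (auto simp: port)
    next
      fix p assume p: "p \<in> ports string_arity ?G"
      obtain v j where vj: "p = (v, j)" by (cases p)
      consider "j = 1" "v \<le> 1" | "j = 1" "2 \<le> v" "v \<le> ?n + 1" | "j = 2" "1 \<le> v" "v \<le> ?n"
        using p unfolding vj port by linarith
      then show "p \<in> \<Union> (edges ?G)"
      proof cases
        case 1
        then have "v = 0 \<or> v = 1" by linarith
        then have "p \<in> {(0, 1), (1, 1)}" using 1 vj by auto
        then show ?thesis using edge by blast
      next
        case 2
        have "p \<in> {(v - 1, 2), (v - 1 + 1, 1)}" using 2 vj by simp
        moreover have "{(v - 1, 2), (v - 1 + 1, 1)} \<in> edges ?G" unfolding edge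
          using 2 by (intro disjI2 exI[of _ "v - 1"]) (simp, linarith)
        ultimately show ?thesis by blast
      next
        case 3
        have "p \<in> {(v, 2), (v + 1, 1)}" using 3 vj by simp
        moreover have "{(v, 2), (v + 1, 1)} \<in> edges ?G" unfolding edge using 3 by blast
        ultimately show ?thesis by blast
      qed
    qed
    show "disjnt h h'" if "h \<in> edges ?G" "h' \<in> edges ?G" "h \<noteq> h'" for h h'
      using that unfolding edge disjnt_def by auto
    show "{} \<notin> edges ?G"
      unfolding edge by auto
  qed
  have "finite (verts ?G)" "verts ?G \<noteq> {}" by (simp_all add: string_hypergraph_def)
  then show ?thesis
    using lab part positive_string_alphabet[OF assms(1)] unfolding hypergraph_over_def by blast
qed

lemma hwm_over_string_tensors:
  assumes "finite \<Sigma>"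
  shows "hwm_over (string_alphabet \<Sigma>) string_arity
    \<lparr> tensor = string_tensors \<iota> M \<tau>, mult = id_product, alpha = (\<chi> i. 1) \<rparr>"
  using positive_string_alphabet[OF assms]
  by (auto simp: hwm_over_def is_product_id_product string_alphabet_def tensor_space_def
      tensor_of_vec_def tensor_of_matrix_def split: list.split)

end

theory Submission
  imports Defs
begin

text \<open>
  For the identity product, a hyperedge contributes 1 if the colouring \<open>\<gamma>\<close> is constant on it and
  0 otherwise.  Hence only colourings that factor through the hyperedges contribute; for \<open>G\<^sub>w\<close> these
  are the state sequences \<open>s\<^sub>0, \<dots>, s\<^sub>n\<close>, and the series becomes the usual expansion of
  the matrix product along \<open>w\<close> as a sum over paths.
\<close>

text \<open>\<open>word_matrix\<close> peels letters off the front, while the induction on paths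
  appends them at the end.\<close>

lemma word_matrix_snoc:
  "word_matrix M (w @ [a]) = word_matrix M w ** M a"
  by (induction w) (auto simp: word_matrix_def matrix_mul_assoc)

text \<open>Summing out the last state of a path absorbs the last letter into the terminal vector.
  The induction therefore runs from the right and keeps \<open>\<tau>\<close> arbitrary.\<close>

lemma dot_word_matrix_eq_sum_paths:
  fixes M :: "'a \<Rightarrow> 'k::field ^ 'd ^ 'd::finite"
  shows "dot \<iota> (word_matrix M w *v \<tau>) =
    (\<Sum>s \<in> {0..length w} \<rightarrow>\<^sub>E (UNIV :: 'd set).
       \<iota> $ s 0 * (\<Prod>i<length w. M (w ! i) $ s i $ s (Suc i)) * \<tau> $ s (length w))"
proof (induction w arbitrary: \<tau> rule: rev_induct)
  case Nil
  have "(\<Sum>s \<in> {0::nat} \<rightarrow>\<^sub>E (UNIV :: 'd set). \<iota> $ s 0 * \<tau> $ s 0) = (\<Sum>i\<in>UNIV. \<iota> $ i * \<tau> $ i)"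
    by (rule sum.reindex_bij_witness[where i = "\<lambda>j. \<lambda>i\<in>{0}. j" and j = "\<lambda>s. s 0"])
      (auto simp: PiE_def extensional_def fun_eq_iff)
  then show ?case by (simp add: word_matrix_def dot_def)
next
  case (snoc a w)
  let ?n = "length w"
  let ?P = "\<lambda>s :: nat \<Rightarrow> 'd. \<Prod>i<?n. M (w ! i) $ s i $ s (Suc i)"
  let ?S = "{0..?n} \<rightarrow>\<^sub>E (UNIV :: 'd set)"
  have range: "{0..length (w @ [a])} = insert (Suc ?n) {0..?n}" by auto
  have prod: "(\<Prod>i<length (w @ [a]). M ((w @ [a]) ! i) $ s i $ s (Suc i)) =
      ?P s * M a $ s ?n $ s (Suc ?n)" for s :: "nat \<Rightarrow> 'd"
    by (simp add: nth_append)
  have upd: "?P (s(Suc ?n := j)) = ?P s" for s j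
    by (intro prod.cong) auto
  \<comment> \<open>A path on \<open>{0..Suc n}\<close> is uniquely a path on \<open>{0..n}\<close>
    together with its last state \<open>j\<close>.\<close>
  have inj: "inj_on (\<lambda>(j, s). s(Suc ?n := j)) (UNIV \<times> ?S)"
    by (rule inj_combinator) simp
  have "(\<Sum>s \<in> {0..length (w @ [a])} \<rightarrow>\<^sub>E (UNIV :: 'd set).
      \<iota> $ s 0 * (\<Prod>i<length (w @ [a]). M ((w @ [a]) ! i) $ s i $ s (Suc i)) *
        \<tau> $ s (length (w @ [a]))) =
      (\<Sum>(j, s) \<in> UNIV \<times> ?S. \<iota> $ s 0 * (?P s * M a $ s ?n $ j) * \<tau> $ j)"
    unfolding range PiE_insert_eq prod
    by (subst sum.reindex[OF inj]) (auto simp: upd intro!: sum.cong)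
  also have "\<dots> = (\<Sum>s \<in> ?S. \<Sum>j\<in>UNIV. \<iota> $ s 0 * (?P s * M a $ s ?n $ j) * \<tau> $ j)"
    by (subst sum.cartesian_product[symmetric]) (rule sum.swap)
  \<comment> \<open>The sum over \<open>j\<close> is an entry of \<open>M a *v \<tau>\<close>, which
    becomes the terminal vector in the induction hypothesis.\<close>
  also have "\<dots> = (\<Sum>s \<in> ?S. \<iota> $ s 0 * ?P s * (M a *v \<tau>) $ s ?n)"
    by (simp add: matrix_vector_mult_def sum_distrib_left mult.assoc)
  also have "\<dots> = dot \<iota> (word_matrix M (w @ [a]) *v \<tau>)"
    by (simp add: snoc.IH[symmetric] word_matrix_snoc matrix_vector_mul_assoc)
  finally show ?case by simp
qed

text \<open>The product of two basis vectors is a basis vector or 0, and pairing with the all-ones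
  vector sends every basis vector to 1.\<close>

lemma dot_big_product_id_product_pair:
  assumes "p \<noteq> q"
  shows "dot (\<chi> i. 1) (big_product id_product (\<lambda>p. axis (\<gamma> p) 1) {p, q}) =
    (if \<gamma> p = \<gamma> q then 1 else (0 :: 'k::field))"
proof -
  have "abel_semigroup (id_product :: 'k ^ 'b \<Rightarrow> _)"
    using is_product_id_product unfolding is_product_def by blast
  then have "big_product id_product (\<lambda>p. axis (\<gamma> p) (1 :: 'k)) {p, q} =
      (if \<gamma> p = \<gamma> q then axis (\<gamma> p) 1 else 0)"
    using assms by (simp add: big_product_insert big_product_singleton id_product_axis)
  then show ?thesis by (simp add: dot_def axis_def)
qed

lemma prod_of_bool:
  assumes "finite A"
  shows "(\<Prod>i\<in>A. if P i then 1 else (0 :: 'k::field)) = (if \<forall>i\<in>A. P i then 1 else 0)"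
  using assms by (auto simp: prod_zero_iff)

lemma prod_edges_string_hypergraph:
  "(\<Prod>h\<in>edges (string_hypergraph w).
      dot (\<chi> i. 1) (big_product id_product (\<lambda>p. axis (\<gamma> p) 1) h)) =
    (if \<gamma> (0, 1) = \<gamma> (1, 1) \<and> (\<forall>i\<in>{1..length w}. \<gamma> (i, 2) = \<gamma> (i + 1, 1))
     then 1 else (0 :: 'k::field))"
proof -
  let ?f = "\<lambda>h. dot (\<chi> i. 1) (big_product id_product (\<lambda>p. axis (\<gamma> p) (1 :: 'k)) h)"
  let ?e = "\<lambda>i :: nat. {(i, 2 :: nat), (i + 1, 1)}"
  \<comment> \<open>Distinct indices must give distinct hyperedges for the product over the edge set
    to become a product over indices.\<close>
  have notin: "{(0, 1), (1, 1)} \<notin> ?e ` {1..length w}"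
    by (simp add: image_iff doubleton_eq_iff)
  have inj: "inj_on ?e {1..length w}"
    by (auto simp: inj_on_def doubleton_eq_iff)
  have "(\<Prod>h\<in>edges (string_hypergraph w). ?f h) =
      ?f {(0, 1), (1, 1)} * (\<Prod>i = 1..length w. ?f (?e i))"
    using notin prod.reindex[OF inj, of ?f] by (simp add: string_hypergraph_def o_def)
  then show ?thesis
    by (simp add: dot_big_product_id_product_pair prod_of_bool)
qed

lemma prod_verts_string_hypergraph:
  "(\<Prod>v\<in>verts (string_hypergraph w).
      string_tensors \<iota> M \<tau> (label (string_hypergraph w) v)
        (map (\<lambda>j. \<gamma> (v, j)) [1..<Suc (string_arity (label (string_hypergraph w) v))])) =
    \<iota> $ \<gamma> (0, 1) * (\<Prod>i<length w. M (w ! i) $ \<gamma> (Suc i, 1) $ \<gamma> (Suc i, 2)) *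
      \<tau> $ \<gamma> (length w + 1, 1)"
proof -
  \<comment> \<open>The shift by \<open>Suc\<close> matches list positions: vertex
    \<open>Suc i\<close> carries the letter \<open>w ! i\<close>.\<close>
  have verts: "verts (string_hypergraph w) = insert 0 (insert (length w + 1) (Suc ` {..<length w}))"
    unfolding image_Suc_lessThan by (auto simp: string_hypergraph_def)
  let ?f = "\<lambda>v. string_tensors \<iota> M \<tau> (label (string_hypergraph w) v)
    (map (\<lambda>j. \<gamma> (v, j)) [1..<Suc (string_arity (label (string_hypergraph w) v))])"
  have "(\<Prod>v\<in>verts (string_hypergraph w). ?f v) =
      ?f 0 * (?f (length w + 1) * (\<Prod>i<length w. ?f (Suc i)))"
    unfolding verts by (simp add: prod.reindex image_iff del: upt_Suc One_nat_def)
  moreover have "?f 0 = \<iota> $ \<gamma> (0, 1)"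
    by (simp add: string_hypergraph_def tensor_of_vec_def)
  moreover have "?f (length w + 1) = \<tau> $ \<gamma> (length w + 1, 1)"
    by (simp add: string_hypergraph_def tensor_of_vec_def)
  moreover have "?f (Suc i) = M (w ! i) $ \<gamma> (Suc i, 1) $ \<gamma> (Suc i, 2)" if "i < length w" for i
    using that by (simp add: string_hypergraph_def tensor_of_matrix_def numeral_2_eq_2)
  ultimately show ?thesis by (simp add: mult_ac)
qed

lemma ports_string_hypergraph:
  "(v, j) \<in> ports string_arity (string_hypergraph w) \<longleftrightarrow>
    v \<le> length w + 1 \<and> (j = 1 \<or> j = 2 \<and> 1 \<le> v \<and> v \<le> length w)"
  by (auto simp: ports_def string_hypergraph_def)

lemma hwm_series_string_hypergraph:
  fixes M :: "'a \<Rightarrow> 'k::field ^ 'd ^ 'd::finite"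
  shows "hwm_series string_arity
      \<lparr> tensor = string_tensors \<iota> M \<tau>, mult = id_product, alpha = (\<chi> i. 1) \<rparr>
      (string_hypergraph w) =
    (\<Sum>s \<in> {0..length w} \<rightarrow>\<^sub>E (UNIV :: 'd set).
       \<iota> $ s 0 * (\<Prod>i<length w. M (w ! i) $ s i $ s (Suc i)) * \<tau> $ s (length w))"
proof -
  let ?n = "length w"
  let ?P = "ports string_arity (string_hypergraph w)"
  let ?F = "\<lambda>\<gamma> :: nat \<times> nat \<Rightarrow> 'd. \<iota> $ \<gamma> (0, 1) *
    (\<Prod>i<?n. M (w ! i) $ \<gamma> (Suc i, 1) $ \<gamma> (Suc i, 2)) * \<tau> $ \<gamma> (?n + 1, 1)"
  let ?ok = "\<lambda>\<gamma> :: nat \<times> nat \<Rightarrow> 'd.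
    \<gamma> (0, 1) = \<gamma> (1, 1) \<and> (\<forall>i\<in>{1..?n}. \<gamma> (i, 2) = \<gamma> (i + 1, 1))"
  let ?col = "\<lambda>s :: nat \<Rightarrow> 'd. \<lambda>p\<in>?P. s (fst p + snd p - 2)"
  \<comment> \<open>State \<open>i\<close> is read off at port \<open>(Suc i, 1)\<close>, which lies
    on hyperedge \<open>i\<close> for every \<open>i \<le> ?n\<close>; port \<open>(i, 2)\<close>
    would be missing for \<open>i = 0\<close>.\<close>
  let ?path = "\<lambda>\<gamma> :: nat \<times> nat \<Rightarrow> 'd. \<lambda>i\<in>{0..?n}. \<gamma> (Suc i, 1)"
  have "finite ?P"
    by (auto simp: ports_def string_hypergraph_def)
  then have fin: "finite (?P \<rightarrow>\<^sub>E (UNIV :: 'd set))"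
    by (simp add: finite_PiE)
  have "hwm_series string_arity
      \<lparr> tensor = string_tensors \<iota> M \<tau>, mult = id_product, alpha = (\<chi> i. 1) \<rparr>
      (string_hypergraph w) =
      (\<Sum>\<gamma> \<in> ?P \<rightarrow>\<^sub>E UNIV. ?F \<gamma> * (if ?ok \<gamma> then 1 else 0))"
    unfolding hwm_series_def hwm.simps prod_verts_string_hypergraph
      prod_edges_string_hypergraph ..
  also have "\<dots> = (\<Sum>\<gamma> \<in> ?P \<rightarrow>\<^sub>E UNIV. if ?ok \<gamma> then ?F \<gamma> else 0)"
    by (intro sum.cong) auto
  also have "\<dots> = (\<Sum>\<gamma> \<in> {\<gamma> \<in> ?P \<rightarrow>\<^sub>E UNIV. ?ok \<gamma>}. ?F \<gamma>)"
    using fin by (rule sum.inter_filter[symmetric])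
  also have "\<dots> = (\<Sum>s \<in> {0..?n} \<rightarrow>\<^sub>E (UNIV :: 'd set).
       \<iota> $ s 0 * (\<Prod>i<?n. M (w ! i) $ s i $ s (Suc i)) * \<tau> $ s ?n)"
    \<comment> \<open>The port \<open>(v, j)\<close> lies on the hyperedge with index \<open>v + j - 2\<close>; truncated subtraction
        makes this correct for the port \<open>(0, 1)\<close> as well.\<close>
  proof (rule sum.reindex_bij_witness[where i = ?col and j = ?path])
    fix \<gamma> assume \<gamma>: "\<gamma> \<in> {\<gamma> \<in> ?P \<rightarrow>\<^sub>E UNIV. ?ok \<gamma>}"
    then have ok: "\<gamma> (0, 1) = \<gamma> (1, 1)" "\<And>i. 1 \<le> i \<Longrightarrow> i \<le> ?n \<Longrightarrow> \<gamma> (i, 2) = \<gamma> (Suc i, 1)"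
      by auto
    show "?col (?path \<gamma>) = \<gamma>"
    proof
      fix p :: "nat \<times> nat"
      obtain v j where p: "p = (v, j)" by fastforce
      show "?col (?path \<gamma>) p = \<gamma> p"
      proof (cases "p \<in> ?P")
        case True
        \<comment> \<open>In the middle case \<open>?path\<close> reads the port itself. In the
          outer two it reads the other port of the hyperedge, and \<open>ok\<close> identifies the
          colours.\<close>
        then consider "v = 0" "j = 1" | "1 \<le> v" "v \<le> ?n + 1" "j = 1" | "j = 2" "1 \<le> v" "v \<le> ?n"
          unfolding p ports_string_hypergraph by linarith
        then show ?thesis
          using True ok unfolding p by cases auto
      next
        case False
        then show ?thesis using \<gamma> by (simp add: PiE_def extensional_def del: split_paired_All)
      qed
    qed
    show "?path \<gamma> \<in> {0..?n} \<rightarrow>\<^sub>E UNIV" by simp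
    \<comment> \<open>State \<open>Suc i\<close> is the colour of \<open>(Suc (Suc i), 1)\<close>,
      equal to that of \<open>(Suc i, 2)\<close> since both lie on hyperedge
      \<open>Suc i\<close>.\<close>
    have "(\<Prod>i<?n. M (w ! i) $ ?path \<gamma> i $ ?path \<gamma> (Suc i)) =
        (\<Prod>i<?n. M (w ! i) $ \<gamma> (Suc i, 1) $ \<gamma> (Suc i, 2))"
      using ok(2) by (intro prod.cong) auto
    then show "\<iota> $ ?path \<gamma> 0 * (\<Prod>i<?n. M (w ! i) $ ?path \<gamma> i $ ?path \<gamma> (Suc i)) *
        \<tau> $ ?path \<gamma> ?n = ?F \<gamma>"
      using ok(1) by simp
  next
    fix s assume s: "s \<in> {0..?n} \<rightarrow>\<^sub>E (UNIV :: 'd set)"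
    then show "?path (?col s) = s"
      by (auto simp: fun_eq_iff ports_string_hypergraph PiE_def extensional_def)
    \<comment> \<open>Both ports of a hyperedge have the same value of
      \<open>fst p + snd p - 2\<close>, so \<open>?col s\<close> is constant on it.\<close>
    show "?col s \<in> {\<gamma> \<in> ?P \<rightarrow>\<^sub>E UNIV. ?ok \<gamma>}"
      by (auto simp: ports_string_hypergraph)
  qed
  finally show ?thesis .
qed

text \<open>The matrix side and the hypergraph side both expand into the same sum over
  paths.\<close>

theorem proposition1:
  fixes \<Sigma> :: "'a set"
    and r :: "'a list \<Rightarrow> 'k::real_normed_field"
    and \<iota> \<tau> :: "'k ^ 'd::finite"
    and M :: "'a \<Rightarrow> 'k ^ 'd ^ 'd"
  assumes "finite \<Sigma>"
    and "\<forall>u \<in> lists \<Sigma>. r u = dot \<iota> (word_matrix M u *v \<tau>)"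
  shows "\<forall>w \<in> lists \<Sigma>.
    r w = hwm_series string_arity
      \<lparr> tensor = string_tensors \<iota> M \<tau>, mult = id_product, alpha = (\<chi> i. 1) \<rparr>
      (string_hypergraph w)"
  using assms(2) by (simp add: hwm_series_string_hypergraph dot_word_matrix_eq_sum_paths)

end
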